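(* Let $\Omega \subseteq \mathbf{R}^n$ be an open set with $C^1$-boundary, and for $r > 0$ define $$ S_r = \Omega \cap \{x : \delta_{\partial \Omega}(x) = r\}. $$ Then the following two conditions are equivalent: (i) $\Omega$ satisfies an inner uniform ball condition on some non-empty (relatively) open subset of $\partial \Omega$; (ii) there exist $r > 0$ and an open set $U \subseteq \Omega$ such that $S_r \cap U$ is a non-empty $C^1$-hypersurface.
   Context: For $S \subseteq \mathbf{R}^n$, the distance function is $\delta_S(x) = \inf\{|x-a| : a \in S\}$, $x \in \mathbf{R}^n$ (with $\inf \varnothing = +\infty$). A subset $M \subseteq \mathbf{R}^n$ is a $C^1$-hypersurface if for every $a \in M$ there exist an open subset $V$ of $\mathbf{R}^n$ with $a \in V$, an $(n-1)$-dimensional linear subspace $Z$ of $\mathbf{R}^n$, and a $C^1$-diffeomorphism $\sigma : V \to \sigma(V)$ onto an open subset of $\mathbf{R}^n$ such that $\sigma(V \cap M) = Z \cap \sigma(V)$. An open set $\Omega \subseteq \mathbf{R}^n$ has $C^1$-boundary if its topological boundary $\partial\Omega$ is a $C^1$-hypersurface. Given an open set $\Omega \subseteq \mathbf{R}^n$ and $S \subseteq \partial \Omega$, we say that $\Omega$ satisfies an inner uniform ball condition on $S$ if there exists $\rho > 0$ such that each point of $S$ belongs to the boundary of an open ball of radius $\rho$ contained in $\Omega$. *)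

theory Defs
  imports "HOL-Analysis.Analysis"
begin

text \<open>The library's \<^const>\<open>infdist\<close> sends the empty set to \<open>0\<close>; with values in the extended
  reals the infimum over the empty set is \<open>\<infinity>\<close>.\<close>

definition dist_fun :: "'a::euclidean_space set \<Rightarrow> 'a \<Rightarrow> ereal" where
  "dist_fun S x = (INF a\<in>S. ereal (norm (x - a)))"

definition C1_on :: "'a::euclidean_space set \<Rightarrow> ('a \<Rightarrow> 'b::euclidean_space) \<Rightarrow> bool" where
  "C1_on V f \<longleftrightarrow>
     (\<exists>f' :: 'a \<Rightarrow> 'a \<Rightarrow>\<^sub>L 'b.
        (\<forall>x\<in>V. (f has_derivative blinfun_apply (f' x)) (at x)) \<and> continuous_on V f')"

definition C1_diffeomorphism ::
    "'a::euclidean_space set \<Rightarrow> 'b::euclidean_space set \<Rightarrow> ('a \<Rightarrow> 'b) \<Rightarrow> bool" where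
  "C1_diffeomorphism V W \<sigma> \<longleftrightarrow>
     open V \<and> open W \<and> bij_betw \<sigma> V W \<and> C1_on V \<sigma> \<and> C1_on W (inv_into V \<sigma>)"

definition C1_hypersurface :: "'a::euclidean_space set \<Rightarrow> bool" where
  "C1_hypersurface M \<longleftrightarrow>
     (\<forall>a\<in>M. \<exists>V Z. \<exists>\<sigma> :: 'a \<Rightarrow> 'a.
        open V \<and> a \<in> V \<and> subspace Z \<and> dim Z = DIM('a) - 1 \<and>
        C1_diffeomorphism V (\<sigma> ` V) \<sigma> \<and> \<sigma> ` (V \<inter> M) = Z \<inter> \<sigma> ` V)"

definition has_C1_boundary :: "'a::euclidean_space set \<Rightarrow> bool" where
  "has_C1_boundary \<Omega> \<longleftrightarrow> C1_hypersurface (frontier \<Omega>)"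

definition inner_uniform_ball_condition ::
    "'a::euclidean_space set \<Rightarrow> 'a set \<Rightarrow> bool" where
  "inner_uniform_ball_condition \<Omega> S \<longleftrightarrow>
     (\<exists>\<rho>>0. \<forall>x\<in>S. \<exists>c. ball c \<rho> \<subseteq> \<Omega> \<and> x \<in> frontier (ball c \<rho>))"

definition inner_parallel_set :: "'a::euclidean_space set \<Rightarrow> real \<Rightarrow> 'a set" where
  "inner_parallel_set \<Omega> r = \<Omega> \<inter> {x. dist_fun (frontier \<Omega>) x = ereal r}"

end

theory Submission
  imports Defs
begin

text \<open>Touching balls determine normals: if a ball avoids a \<open>C\<^sup>1\<close>-hypersurface \<open>M\<close> and \<open>a \<in> M\<close> lies on its
  boundary, then its centre is \<open>a \<plusminus> r \<nu>(a)\<close>, with \<open>\<nu>\<close> the unit normal.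

  (i) implies (ii): on a smaller piece of the boundary the balls of radius \<open>\<rho>\<close> all lie on the side of \<open>\<nu>\<close>.
  Then every point near \<open>a + (\<rho>/2) \<nu>(a)\<close> has a unique nearest boundary point, depending continuously
  on it, so the squared distance function is \<open>C\<^sup>1\<close> there with nonzero gradient, and \<open>S\<^sub>r\<close> with
  \<open>r = \<rho>/2\<close> is a regular level set.

  (ii) implies (i): the ball of radius \<open>r\<close> about a nearest boundary point of \<open>x \<in> S\<^sub>r\<close> avoids \<open>S\<^sub>r\<close>,
  so the nearest point is \<open>x \<plusminus> r \<nu>(x)\<close>, where \<open>\<nu>\<close> is now normal to \<open>S\<^sub>r\<close>; locally one sign works
  throughout and gives a continuous map into the boundary. Since \<open>x\<close> is in turn determined by the
  normal at its image, this map is locally injective, hence open by invariance of domain, and each of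
  its values lies on the sphere of radius \<open>r\<close> about \<open>x\<close>.\<close>

section \<open>Local equations of hypersurfaces and their normal directions\<close>

text \<open>A regular level set. The gradient \<open>g\<close> of \<open>h\<close> is carried along
  as a vector field, so that \<open>sgn (g y)\<close> is a continuous unit normal along
  \<open>M\<close> in \<open>V\<close>.\<close>

definition local_equation ::
    "'a::euclidean_space set \<Rightarrow> 'a set \<Rightarrow> ('a \<Rightarrow> real) \<Rightarrow> ('a \<Rightarrow> 'a) \<Rightarrow> bool" where
  "local_equation M V h g \<longleftrightarrow>
     open V \<and> (\<forall>y\<in>V. (h has_derivative (\<lambda>v. g y \<bullet> v)) (at y)) \<and> continuous_on V g \<and>
     (\<forall>y\<in>V. g y \<noteq> 0) \<and> M \<inter> V = {y \<in> V. h y = 0}"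

lemma local_equation_subset:
  assumes "local_equation M V h g" "open W" "W \<subseteq> V"
  shows "local_equation M W h g"
  using assms unfolding local_equation_def by (auto intro: continuous_on_subset)

text \<open>In finite dimension, continuity in operator norm can be tested on basis vectors; this
  lets later derivatives be handled as plain functions of a point and a vector.\<close>

lemma continuous_on_Blinfun:
  fixes f :: "'c::t2_space \<Rightarrow> 'a::euclidean_space \<Rightarrow> 'b::euclidean_space"
  assumes "\<And>x. x \<in> S \<Longrightarrow> bounded_linear (f x)" and "\<And>v. continuous_on S (\<lambda>x. f x v)"
  shows "continuous_on S (\<lambda>x. Blinfun (f x))"
proof -
  have "continuous_on S (\<lambda>x. blinfun_apply (Blinfun (f x)) i)" for i
    using assms(2)[of i] by (rule continuous_on_eq) (simp add: assms(1) bounded_linear_Blinfun_apply)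
  then show ?thesis by (rule continuous_on_blinfun_componentwise)
qed

lemma C1_onI:
  fixes f :: "'a::euclidean_space \<Rightarrow> 'b::euclidean_space"
  assumes "\<And>x. x \<in> S \<Longrightarrow> (f has_derivative f' x) (at x)" and "\<And>v. continuous_on S (\<lambda>x. f' x v)"
  shows "C1_on S f"
  unfolding C1_on_def
proof (intro exI conjI ballI)
  show "(f has_derivative blinfun_apply (Blinfun (f' x))) (at x)" if "x \<in> S" for x
    using assms(1)[OF that] by (simp add: bounded_linear_Blinfun_apply has_derivative_bounded_linear)
  show "continuous_on S (\<lambda>x. Blinfun (f' x))"
    by (rule continuous_on_Blinfun) (use assms has_derivative_bounded_linear in blast)+
qed

lemma C1_on_imp_continuous_on: "C1_on S f \<Longrightarrow> continuous_on S f"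
  unfolding C1_on_def
  by (meson continuous_at_imp_continuous_on has_derivative_continuous)

text \<open>If \<open>c - a\<close> had a component \<open>v\<close> orthogonal to the gradient, then by the intermediate value theorem
  \<open>M\<close> would contain points \<open>a + t (v + s \<nabla>h(a))\<close> with \<open>t > 0\<close> and \<open>s\<close> small, and these lie in the ball.\<close>

lemma normal_to_empty_ball:
  fixes M :: "'a::euclidean_space set"
  assumes eq: "local_equation M V h g" and a: "a \<in> M" "a \<in> V" and empty: "ball c (dist a c) \<inter> M = {}"
  obtains s where "c - a = s *\<^sub>R g a"
proof (rule ccontr)
  assume no: "\<not> thesis"
  define p where "p = c - a"
  define G where "G = g a"
  have G: "G \<bullet> G > 0"
    using eq a by (auto simp: local_equation_def G_def)
  define v where "v = p - ((p \<bullet> G) / (G \<bullet> G)) *\<^sub>R G"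
  have vG: "v \<bullet> G = 0"
    using G by (simp add: v_def inner_diff_left)
  have pv: "p \<bullet> v = v \<bullet> v"
    using vG by (simp add: v_def inner_diff_left inner_commute algebra_simps)
  have "v \<noteq> 0"
    using no that by (auto simp: v_def p_def G_def)
  then have v: "v \<bullet> v > 0" by simp
  \<comment> \<open>With this \<open>e\<close>, tilting \<open>v\<close> by
    \<open>s *\<^sub>R G\<close> for \<open>\<bar>s\<bar> \<le> e\<close> costs at most half of
    \<open>p \<bullet> v = v \<bullet> v\<close>. The summand \<open>1\<close> keeps the denominator
    positive when \<open>p \<bullet> G = 0\<close>.\<close>
  define e where "e = (v \<bullet> v) / (2 * (\<bar>p \<bullet> G\<bar> + 1))"
  have e: "e > 0" using v by (simp add: e_def add_nonneg_pos)
  have ep: "e * \<bar>p \<bullet> G\<bar> \<le> (v \<bullet> v) / 2"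
  proof -
    have "e * \<bar>p \<bullet> G\<bar> \<le> e * (\<bar>p \<bullet> G\<bar> + 1)" using e by simp
    also have "\<dots> = (v \<bullet> v) / 2"
      by (simp add: e_def divide_simps)
    finally show ?thesis .
  qed
  define K where "K = v \<bullet> v + e\<^sup>2 * (G \<bullet> G)"
  have K: "K > 0" using v G e by (simp add: K_def add_pos_nonneg)
  have h0: "h a = 0" using eq a by (auto simp: local_equation_def)
  have der: "((\<lambda>t. h (a + t *\<^sub>R w)) has_real_derivative G \<bullet> w) (at 0)" for w
  proof -
    have "((\<lambda>t. h (a + t *\<^sub>R w)) has_derivative (\<lambda>t. G \<bullet> (t *\<^sub>R w))) (at 0)"
    proof (rule has_derivative_compose[where g = h and f = "\<lambda>t. a + t *\<^sub>R w"])
      show "((\<lambda>t. a + t *\<^sub>R w) has_derivative (\<lambda>t. t *\<^sub>R w)) (at 0)"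
        by (auto intro!: derivative_eq_intros)
      show "(h has_derivative (\<bullet>) G) (at (a + 0 *\<^sub>R w))"
        using eq a by (auto simp: local_equation_def G_def)
    qed
    moreover have "(\<lambda>t. G \<bullet> (t *\<^sub>R w)) = (*) (G \<bullet> w)" by (auto simp: mult.commute)
    ultimately show ?thesis by (simp add: has_field_derivative_def)
  qed
  obtain d1 where d1: "d1 > 0" "\<And>t. 0 < t \<Longrightarrow> t < d1 \<Longrightarrow> h (a + t *\<^sub>R (v + e *\<^sub>R G)) > 0"
    using DERIV_pos_inc_right[OF der[of "v + e *\<^sub>R G"]] G e vG h0
    by (auto simp: inner_add_right inner_commute)
  obtain d2 where d2: "d2 > 0" "\<And>t. 0 < t \<Longrightarrow> t < d2 \<Longrightarrow> h (a + t *\<^sub>R (v - e *\<^sub>R G)) < 0"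
    using DERIV_neg_dec_right[OF der[of "v - e *\<^sub>R G"]] G e vG h0
    by (auto simp: inner_diff_right inner_commute)
  obtain d3 where d3: "d3 > 0" "ball a d3 \<subseteq> V"
    using eq a open_contains_ball by (metis local_equation_def)
  \<comment> \<open>The four bounds serve, in order, the sign of \<open>h\<close> at the two ends
    \<open>s = e\<close> and \<open>s = -e\<close>, staying inside \<open>V\<close>, and making the
    quadratic term \<open>t\<^sup>2 * K\<close> smaller than the linear gain
    \<open>t * (v \<bullet> v)\<close>.\<close>
  define m where "m = min (min d1 d2) (min (d3 / sqrt K) ((v \<bullet> v) / K))"
  have m: "0 < m" "m \<le> d1" "m \<le> d2" "m \<le> d3 / sqrt K" "m \<le> (v \<bullet> v) / K"
    using d1 d2 d3 K v by (simp_all add: m_def)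
  define t where "t = m / 2"
  have t: "0 < t" "t < d1" "t < d2" "t < d3 / sqrt K" "t < (v \<bullet> v) / K"
  proof -
    have "0 < t" "t < m" using m by (simp_all add: t_def)
    then show "0 < t" "t < d1" "t < d2" "t < d3 / sqrt K" "t < (v \<bullet> v) / K"
      using m by linarith+
  qed
  have nrm: "(norm (v + s *\<^sub>R G))\<^sup>2 \<le> K" if "\<bar>s\<bar> \<le> e" for s
  proof -
    have "s\<^sup>2 \<le> e\<^sup>2" using that e by (metis abs_le_square_iff abs_of_pos)
    moreover have "(norm (v + s *\<^sub>R G))\<^sup>2 = v \<bullet> v + s\<^sup>2 * (G \<bullet> G)"
      unfolding power2_norm_eq_inner inner_add_left inner_add_right inner_scaleR_left inner_scaleR_right
      using vG by (simp add: inner_commute[of G v] power2_eq_square)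
    ultimately show ?thesis using G by (simp add: K_def)
  qed
  have inV: "a + t *\<^sub>R (v + s *\<^sub>R G) \<in> V" if "\<bar>s\<bar> \<le> e" for s
  proof -
    have "norm (v + s *\<^sub>R G) \<le> sqrt K" using nrm[OF that] by (simp add: real_le_rsqrt)
    then have "t * norm (v + s *\<^sub>R G) < d3"
      using t K by (smt (verit) mult_left_mono pos_less_divide_eq real_sqrt_gt_zero)
    then show ?thesis using d3 t by (auto simp: dist_norm)
  qed
  have "\<exists>s\<ge>-e. s \<le> e \<and> h (a + t *\<^sub>R (v + s *\<^sub>R G)) = 0"
  proof (rule IVT')
    show "h (a + t *\<^sub>R (v + (- e) *\<^sub>R G)) \<le> 0" using d2(2)[of t] t by simp
    show "0 \<le> h (a + t *\<^sub>R (v + e *\<^sub>R G))" using d1(2)[of t] t by simp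
    have "continuous_on V h"
      using eq unfolding local_equation_def
      by (meson continuous_at_imp_continuous_on has_derivative_continuous)
    then show "continuous_on {- e..e} (\<lambda>s. h (a + t *\<^sub>R (v + s *\<^sub>R G)))"
      by (rule continuous_on_compose2) (use inV in \<open>auto intro!: continuous_intros\<close>)
  qed (use e in simp)
  then obtain s where s: "\<bar>s\<bar> \<le> e" "h (a + t *\<^sub>R (v + s *\<^sub>R G)) = 0"
    by (metis abs_le_iff minus_le_iff)
  define y where "y = a + t *\<^sub>R (v + s *\<^sub>R G)"
  have "y \<in> M" using inV[OF s(1)] s(2) eq by (auto simp: y_def local_equation_def)
  have "\<bar>s * (p \<bullet> G)\<bar> \<le> e * \<bar>p \<bullet> G\<bar>"
    using s(1) by (simp add: abs_mult mult_right_mono)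
  then have ps: "p \<bullet> (v + s *\<^sub>R G) \<ge> (v \<bullet> v) / 2"
    using ep pv by (simp add: inner_add_right)
  have "(norm (c - y))\<^sup>2 = (norm p)\<^sup>2 - 2 * t * (p \<bullet> (v + s *\<^sub>R G)) + t\<^sup>2 * (norm (v + s *\<^sub>R G))\<^sup>2"
  proof -
    have "c - y = p - t *\<^sub>R (v + s *\<^sub>R G)" by (simp add: y_def p_def)
    then have "(norm (c - y))\<^sup>2 = (p - t *\<^sub>R (v + s *\<^sub>R G)) \<bullet> (p - t *\<^sub>R (v + s *\<^sub>R G))"
      by (simp add: power2_norm_eq_inner)
    also have "\<dots> = p \<bullet> p - 2 * t * (p \<bullet> (v + s *\<^sub>R G)) + t\<^sup>2 * ((v + s *\<^sub>R G) \<bullet> (v + s *\<^sub>R G))"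
      unfolding inner_diff_left inner_diff_right inner_scaleR_left inner_scaleR_right
      by (simp add: inner_commute[of "v + s *\<^sub>R G" p] power2_eq_square right_diff_distrib)
    finally show ?thesis by (simp add: power2_norm_eq_inner)
  qed
  also have "\<dots> \<le> (norm p)\<^sup>2 - t * (v \<bullet> v) + t\<^sup>2 * K"
  proof -
    have "t * (v \<bullet> v) \<le> 2 * t * (p \<bullet> (v + s *\<^sub>R G))"
      using ps t by (simp add: field_simps)
    moreover have "t\<^sup>2 * (norm (v + s *\<^sub>R G))\<^sup>2 \<le> t\<^sup>2 * K"
      using nrm[OF s(1)] by (simp add: mult_left_mono)
    ultimately show ?thesis by linarith
  qed
  also have "\<dots> < (norm p)\<^sup>2"
  proof -
    have "t * K < v \<bullet> v" using t(5) K by (simp add: pos_less_divide_eq)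
    then have "t * (t * K) < t * (v \<bullet> v)" using t by simp
    then show ?thesis by (simp add: power2_eq_square algebra_simps)
  qed
  finally have "dist c y < dist a c"
    by (simp add: dist_norm p_def norm_minus_commute power_less_imp_less_base)
  with \<open>y \<in> M\<close> empty show False by auto
qed

section \<open>Passage between charts and local equations\<close>

text \<open>If \<open>z\<close> is normal to the hyperplane \<open>Z\<close> of a chart
  \<open>\<sigma>\<close>, then \<open>z \<bullet> \<sigma> y\<close> vanishes exactly on
  \<open>M\<close>, and its gradient is nonzero because the derivative of \<open>\<sigma>\<close> is
  onto.\<close>

lemma C1_hypersurface_imp_local_equation:
  fixes M :: "'a::euclidean_space set"
  assumes "C1_hypersurface M" "a \<in> M"
  obtains V h g where "a \<in> V" "local_equation M V h g"
proof -
  obtain V Z and \<sigma> :: "'a \<Rightarrow> 'a" where V: "open V" "a \<in> V" and Z: "subspace Z" "dim Z = DIM('a) - 1"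
    and \<sigma>: "C1_diffeomorphism V (\<sigma> ` V) \<sigma>" and MZ: "\<sigma> ` (V \<inter> M) = Z \<inter> \<sigma> ` V"
    using assms unfolding C1_hypersurface_def by meson
  obtain z where z: "z \<noteq> 0" "Z = {x. z \<bullet> x = 0}"
  proof -
    have "span Z \<subset> span (UNIV :: 'a set)"
      using Z by (metis DIM_positive One_nat_def Suc_pred dim_UNIV dim_span lessI nat_less_le span_UNIV top.not_eq_extremum)
    then obtain z where z: "z \<noteq> 0" "\<And>x. x \<in> Z \<Longrightarrow> z \<bullet> x = 0"
      using orthogonal_to_subspace_exists_gen[of Z UNIV] by (metis orthogonal_def span_base)
    have "Z = {x. z \<bullet> x = 0}"
      by (rule subspace_dim_equal) (use Z z in \<open>auto simp: subspace_hyperplane dim_hyperplane\<close>)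
    with z that show thesis by blast
  qed
  obtain \<sigma>' where \<sigma>': "\<And>x. x \<in> V \<Longrightarrow> (\<sigma> has_derivative blinfun_apply (\<sigma>' x)) (at x)" "continuous_on V \<sigma>'"
    using \<sigma> unfolding C1_diffeomorphism_def C1_on_def by blast
  obtain \<tau>' where \<tau>': "\<And>x. x \<in> \<sigma> ` V \<Longrightarrow> (inv_into V \<sigma> has_derivative blinfun_apply (\<tau>' x)) (at x)"
    using \<sigma> unfolding C1_diffeomorphism_def C1_on_def by blast
  have inj: "inj_on \<sigma> V" and op: "open (\<sigma> ` V)"
    using \<sigma> by (auto simp: C1_diffeomorphism_def bij_betw_def)
  define h where "h = (\<lambda>y. z \<bullet> \<sigma> y)"
  \<comment> \<open>The vector representing the linear functional that sends \<open>v\<close> to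
    \<open>z \<bullet> \<sigma>' y v\<close>.\<close>
  define g where "g = (\<lambda>y. \<Sum>b\<in>Basis. (z \<bullet> \<sigma>' y b) *\<^sub>R b)"
  have g: "g y \<bullet> v = z \<bullet> \<sigma>' y v" for y v
  proof -
    have "z \<bullet> \<sigma>' y v = z \<bullet> \<sigma>' y (\<Sum>b\<in>Basis. (v \<bullet> b) *\<^sub>R b)" by (simp add: euclidean_representation)
    also have "\<dots> = (\<Sum>b\<in>Basis. (v \<bullet> b) * (z \<bullet> \<sigma>' y b))"
      by (simp add: blinfun.sum_right blinfun.scaleR_right inner_sum_right)
    also have "\<dots> = v \<bullet> g y"
      by (simp add: g_def inner_sum_right mult.commute)
    also have "\<dots> = g y \<bullet> v"
      by (rule inner_commute)
    finally show ?thesis by simp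
  qed
  have "local_equation M V h g"
    unfolding local_equation_def
  proof (intro conjI ballI)
    show "open V" by fact
    show "(h has_derivative (\<lambda>v. g y \<bullet> v)) (at y)" if "y \<in> V" for y
      unfolding h_def g using \<sigma>'(1)[OF that] by (auto intro!: derivative_eq_intros)
    show "continuous_on V g"
      unfolding g_def by (intro continuous_intros \<sigma>')
    show "g y \<noteq> 0" if y: "y \<in> V" for y
    proof
      assume 0: "g y = 0"
      \<comment> \<open>Differentiating \<open>\<sigma>\<close> after its inverse shows that
        \<open>\<sigma>' y\<close> is onto; a vanishing \<open>g y\<close> would make
        \<open>z\<close> orthogonal to its whole range, hence to itself.\<close>
      have "((\<lambda>w. \<sigma> (inv_into V \<sigma> w)) has_derivative (\<lambda>w. \<sigma>' y (\<tau>' (\<sigma> y) w))) (at (\<sigma> y))"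
        by (rule has_derivative_compose[OF \<tau>']) (use y \<sigma>' inj in auto)
      then have "((\<lambda>w. w) has_derivative (\<lambda>w. \<sigma>' y (\<tau>' (\<sigma> y) w))) (at (\<sigma> y))"
        by (rule has_derivative_transform_within_open[OF _ op]) (use y in \<open>auto simp: f_inv_into_f\<close>)
      then have "(\<lambda>w. \<sigma>' y (\<tau>' (\<sigma> y) w)) = (\<lambda>w. w)"
        using has_derivative_unique has_derivative_ident by blast
      then have "z \<bullet> z = z \<bullet> \<sigma>' y (\<tau>' (\<sigma> y) z)" by metis
      also have "\<dots> = 0" using g[of y] 0 by simp
      finally show False using z by simp
    qed
    show "M \<inter> V = {y \<in> V. h y = 0}"
    proof -
      have "y \<in> M \<longleftrightarrow> \<sigma> y \<in> Z" if "y \<in> V" for y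
        using MZ inj that by (metis IntD1 IntI Int_commute Int_iff imageI inj_on_image_mem_iff inf_le2)
      then show ?thesis by (auto simp: h_def z)
    qed
  qed
  with V that show thesis by blast
qed

text \<open>The inverse function theorem turns a regular equation into a chart whose hyperplane is
  orthogonal to the gradient at \<open>a\<close>.\<close>

lemma local_equations_imp_C1_hypersurface:
  fixes M :: "'a::euclidean_space set"
  assumes "\<And>a. a \<in> M \<Longrightarrow> \<exists>V h g. a \<in> V \<and> local_equation M V h g"
  shows "C1_hypersurface M"
  unfolding C1_hypersurface_def
proof
  fix a assume a: "a \<in> M"
  then obtain V h g where aV: "a \<in> V" and eq: "local_equation M V h g"
    using assms by blast
  have V: "open V" and dh: "\<And>y. y \<in> V \<Longrightarrow> (h has_derivative (\<lambda>v. g y \<bullet> v)) (at y)"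
    and cg: "continuous_on V g" and g0: "\<And>y. y \<in> V \<Longrightarrow> g y \<noteq> 0" and MV: "M \<inter> V = {y \<in> V. h y = 0}"
    using eq by (auto simp: local_equation_def)
  \<comment> \<open>Replacing the coordinate along \<open>u\<close> by \<open>h\<close> straightens \<open>M\<close>; \<open>D\<close> and \<open>E\<close> are the derivative of this map
    and its explicit inverse.\<close>
  define u where "u = g a /\<^sub>R norm (g a)"
  have u: "u \<bullet> u = 1" using g0[OF aV] by (simp add: u_def dot_square_norm power2_eq_square)
  \<comment> \<open>Where \<open>h\<close> has positive derivative along \<open>u\<close>,
    exchanging the \<open>u\<close>-coordinate for \<open>h\<close> has an invertible
    derivative.\<close>
  define N where "N = {y \<in> V. g y \<bullet> u > 0}"
  have "open N"
  proof -
    have "open (V \<inter> (\<lambda>y. g y \<bullet> u) -` {0<..})"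
      by (rule continuous_open_preimage[OF _ V]) (auto intro!: continuous_intros cg)
    then show ?thesis by (simp add: N_def vimage_def Int_def)
  qed
  have NV: "N \<subseteq> V" by (auto simp: N_def)
  have aN: "a \<in> N"
    using aV g0[OF aV] by (simp add: N_def u_def)
  define \<sigma> where "\<sigma> = (\<lambda>y. y + (h y - y \<bullet> u) *\<^sub>R u)"
  define D where "D = (\<lambda>y v. v + (g y \<bullet> v - v \<bullet> u) *\<^sub>R u)"
  \<comment> \<open>Solving \<open>D y v = w\<close>: the parts of \<open>v\<close> and
    \<open>w\<close> orthogonal to \<open>u\<close> agree, and
    \<open>g y \<bullet> v = w \<bullet> u\<close> determines the coefficient of
    \<open>u\<close>.\<close>
  define E where "E = (\<lambda>y w. w - (w \<bullet> u) *\<^sub>R u +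
    ((w \<bullet> u - g y \<bullet> w + (w \<bullet> u) * (g y \<bullet> u)) / (g y \<bullet> u)) *\<^sub>R u)"
  have d\<sigma>: "(\<sigma> has_derivative D y) (at y)" if "y \<in> N" for y
    unfolding \<sigma>_def D_def using dh[of y] NV that by (auto intro!: derivative_eq_intros)
  have cD: "continuous_on N (\<lambda>y. D y v)" for v
    unfolding D_def using continuous_on_subset[OF cg NV] by (intro continuous_intros)
  have DE: "D y (E y w) = w" if "y \<in> N" for y w
  proof -
    have gu: "g y \<bullet> u \<noteq> 0" using that by (auto simp: N_def)
    have 1: "E y w \<bullet> u = (w \<bullet> u - g y \<bullet> w + (w \<bullet> u) * (g y \<bullet> u)) / (g y \<bullet> u)"
      by (simp add: E_def inner_add_left inner_diff_left u)
    have 2: "g y \<bullet> E y w = w \<bullet> u"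
      using gu by (simp add: E_def inner_add_right inner_diff_right)
    show ?thesis
      unfolding D_def 1 2 by (simp add: E_def algebra_simps)
  qed
  have ED: "E y (D y v) = v" if "y \<in> N" for y v
  proof -
    have gu: "g y \<bullet> u \<noteq> 0" using that by (auto simp: N_def)
    have 1: "D y v \<bullet> u = g y \<bullet> v"
      by (simp add: D_def inner_add_left inner_diff_left u)
    have 2: "g y \<bullet> D y v = g y \<bullet> v + (g y \<bullet> v - v \<bullet> u) * (g y \<bullet> u)"
      by (simp add: D_def inner_add_right)
    have "(g y \<bullet> v - (g y \<bullet> v + (g y \<bullet> v - v \<bullet> u) * (g y \<bullet> u)) + (g y \<bullet> v) * (g y \<bullet> u)) / (g y \<bullet> u) = v \<bullet> u"
      using gu by (simp add: field_simps)
    then show ?thesis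
      unfolding E_def 1 2 by (simp add: D_def algebra_simps)
  qed
  have blD: "bounded_linear (D y)" if "y \<in> N" for y
    using d\<sigma>[OF that] has_derivative_bounded_linear by blast
  have blE: "bounded_linear (E y)" for y
    unfolding E_def divide_inverse
    by (intro bounded_linear_add bounded_linear_sub bounded_linear_ident bounded_linear_scaleR_const
        bounded_linear_inner_left bounded_linear_inner_right bounded_linear_mult_const bounded_linear_const_mult)
  obtain U W \<tau> \<tau>' where U: "open U" "U \<subseteq> N" "a \<in> U" "open W" "\<sigma> a \<in> W" "homeomorphism U W \<sigma> \<tau>"
    and \<tau>': "\<And>y. y \<in> W \<Longrightarrow> (\<tau> has_derivative (\<tau>' y)) (at y)"
    "\<And>y. y \<in> W \<Longrightarrow> \<tau>' y = inv (blinfun_apply (Blinfun (D (\<tau> y))))"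
  proof (rule inverse_function_theorem[OF \<open>open N\<close>, of \<sigma> "\<lambda>y. Blinfun (D y)" a "Blinfun (E a)"])
    show "(\<sigma> has_derivative blinfun_apply (Blinfun (D x))) (at x)" if "x \<in> N" for x
      using d\<sigma>[OF that] blD[OF that] by (simp add: bounded_linear_Blinfun_apply)
    show "continuous_on N (\<lambda>y. Blinfun (D y))"
      by (intro continuous_on_Blinfun blD cD)
    show "Blinfun (E a) o\<^sub>L Blinfun (D a) = id_blinfun"
      by (rule blinfun_eqI) (simp add: bounded_linear_Blinfun_apply blD blE aN ED)
  qed (use aN in auto)
  have UW: "\<sigma> ` U = W" and c\<tau>: "continuous_on W \<tau>" and \<tau>U: "\<tau> ` W = U"
    and \<tau>\<sigma>: "\<And>y. y \<in> U \<Longrightarrow> \<tau> (\<sigma> y) = y" and \<sigma>\<tau>: "\<And>w. w \<in> W \<Longrightarrow> \<sigma> (\<tau> w) = w"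
    using U(6) by (auto simp: homeomorphism_def)
  have inj: "inj_on \<sigma> U" by (metis \<tau>\<sigma> inj_onI)
  have inv: "inv_into U \<sigma> w = \<tau> w" if "w \<in> W" for w
    using that inj UW \<tau>U \<sigma>\<tau> by (metis imageI inv_into_f_eq)
  have \<tau>E: "\<tau>' w = E (\<tau> w)" if "w \<in> W" for w
  proof -
    have \<tau>w: "\<tau> w \<in> N" using that \<tau>U U by blast
    show ?thesis
      unfolding \<tau>'(2)[OF that]
      by (rule inv_equality) (simp_all add: bounded_linear_Blinfun_apply blD \<tau>w ED DE)
  qed
  have diffeo: "C1_diffeomorphism U (\<sigma> ` U) \<sigma>"
    unfolding C1_diffeomorphism_def
  proof (intro conjI)
    show "open (\<sigma> ` U)" "open U" using U UW by auto
    show "bij_betw \<sigma> U (\<sigma> ` U)" using inj by (simp add: bij_betw_def)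
    show "C1_on U \<sigma>"
      by (rule C1_onI[of _ _ D]) (use U d\<sigma> in blast, rule continuous_on_subset[OF cD U(2)])
    show "C1_on (\<sigma> ` U) (inv_into U \<sigma>)"
      unfolding UW
    proof (rule C1_onI)
      show "(inv_into U \<sigma> has_derivative E (\<tau> w)) (at w)" if "w \<in> W" for w
        using has_derivative_transform_within_open[OF \<tau>'(1)[OF that] \<open>open W\<close> that] inv \<tau>E[OF that] by simp
      have "continuous_on W (\<lambda>w. g (\<tau> w))"
        by (rule continuous_on_compose2[OF cg c\<tau>]) (use \<tau>U U NV in blast)
      then show "continuous_on W (\<lambda>w. E (\<tau> w) v)" for v
        unfolding E_def using \<tau>U U(2) by (intro continuous_intros) (auto simp: N_def)
    qed
  qed
  have \<sigma>u: "u \<bullet> \<sigma> y = h y" for y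
    by (simp add: \<sigma>_def inner_add_right u inner_commute[of u y])
  have "\<sigma> ` (U \<inter> M) = {x. u \<bullet> x = 0} \<inter> \<sigma> ` U"
  proof -
    have "y \<in> M \<longleftrightarrow> h y = 0" if "y \<in> U" for y
      using MV that U NV by blast
    then show ?thesis using \<sigma>u by auto
  qed
  moreover have "u \<noteq> 0" using u by auto
  ultimately show "\<exists>V Z. \<exists>\<sigma> :: 'a \<Rightarrow> 'a. open V \<and> a \<in> V \<and> subspace Z \<and> dim Z = DIM('a) - 1 \<and>
      C1_diffeomorphism V (\<sigma> ` V) \<sigma> \<and> \<sigma> ` (V \<inter> M) = Z \<inter> \<sigma> ` V"
    using U diffeo by (metis subspace_hyperplane dim_hyperplane)
qed


section \<open>Unit normals and centres of touching balls\<close>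

lemma local_equation_uminus: "local_equation M V h g \<Longrightarrow> local_equation M V (\<lambda>y. - h y) (\<lambda>y. - g y)"
  unfolding local_equation_def by (auto intro!: derivative_eq_intros continuous_intros)

lemma continuous_on_unit_normal: "local_equation M V h g \<Longrightarrow> continuous_on V (\<lambda>y. sgn (g y))"
  unfolding local_equation_def by (auto intro: continuous_intros)

lemma norm_unit_normal: "local_equation M V h g \<Longrightarrow> y \<in> V \<Longrightarrow> norm (sgn (g y)) = 1"
  by (simp add: local_equation_def norm_sgn)

text \<open>The vector \<open>c - a\<close> is a multiple of the gradient and has length
  \<open>r\<close>, which leaves only the sign open.\<close>

lemma center_of_empty_ball:
  fixes M :: "'a::euclidean_space set"
  assumes eq: "local_equation M V h g" and a: "a \<in> M" "a \<in> V"
    and r: "dist a c = r" "ball c r \<inter> M = {}"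
  shows "c = a + r *\<^sub>R sgn (g a) \<or> c = a - r *\<^sub>R sgn (g a)"
proof -
  obtain s where s: "c - a = s *\<^sub>R g a"
    using normal_to_empty_ball[OF eq a] r by blast
  have g: "g a = norm (g a) *\<^sub>R sgn (g a)"
    by (cases "g a = 0") (simp_all add: sgn_div_norm)
  have "r = \<bar>s * norm (g a)\<bar>"
    using r(1) s by (metis abs_mult abs_norm_cancel dist_commute dist_norm norm_scaleR)
  then have "s * norm (g a) = r \<or> s * norm (g a) = - r" by linarith
  moreover have "c = a + (s * norm (g a)) *\<^sub>R sgn (g a)"
    using s g by (metis add_diff_cancel_left' diff_add_cancel add.commute scaleR_scaleR)
  ultimately show ?thesis by auto
qed

text \<open>Both sides must be allowed, since \<open>\<Omega>\<close> may lie on both sides of its boundary. If one sign fails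
  at a point then, \<open>T\<close> being closed, it fails near that point and the other sign works there.\<close>

lemma choose_side:
  fixes M :: "'a::euclidean_space set"
  assumes eq: "local_equation M V h g" and ne: "M \<inter> V \<noteq> {}" and T: "closed T"
    and side: "\<And>y. y \<in> M \<inter> V \<Longrightarrow> y + r *\<^sub>R sgn (g y) \<in> T \<or> y - r *\<^sub>R sgn (g y) \<in> T"
  shows "\<exists>W h' g'. local_equation M W h' g' \<and> M \<inter> W \<noteq> {} \<and> (\<forall>y \<in> M \<inter> W. y + r *\<^sub>R sgn (g' y) \<in> T)"
proof (cases "\<forall>y \<in> M \<inter> V. y + r *\<^sub>R sgn (g y) \<in> T")
  case True
  then show ?thesis using eq ne by blast
next
  case False
  define W where "W = V \<inter> (\<lambda>y. y + r *\<^sub>R sgn (g y)) -` (- T)"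
  have "open W"
    unfolding W_def
    by (rule continuous_open_preimage)
      (use eq T in \<open>auto simp: local_equation_def open_Compl intro!: continuous_intros\<close>)
  then have "local_equation M W (\<lambda>y. - h y) (\<lambda>y. - g y)"
    using local_equation_subset[OF local_equation_uminus[OF eq]] by (simp add: W_def)
  moreover have "y + r *\<^sub>R sgn (- g y) \<in> T" if "y \<in> M \<inter> W" for y
    using side[of y] that by (auto simp: W_def sgn_minus)
  moreover have "M \<inter> W \<noteq> {}" using False by (auto simp: W_def)
  ultimately show ?thesis
    by (intro exI[of _ W] exI[of _ "\<lambda>y. - h y"] exI[of _ "\<lambda>y. - g y"]) simp
qed

section \<open>Nearest points and the distance function\<close>

lemma ball_Int_eq_empty_if_le_infdist:
  assumes "r \<le> infdist x K"
  shows "ball x r \<inter> K = {}"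
  using assms by (auto simp: not_less dest: infdist_le[of _ K x])

text \<open>A connected set that meets both \<open>S\<close> and its complement meets the frontier
  of \<open>S\<close>.\<close>

lemma ball_subset_if_disjoint_frontier:
  fixes S :: "'a::euclidean_space set"
  assumes "c \<in> S" "r > 0" "ball c r \<inter> frontier S = {}"
  shows "ball c r \<subseteq> S"
proof (rule ccontr)
  assume "\<not> ball c r \<subseteq> S"
  then show False
    using connected_Int_frontier[of "ball c r" S] assms by (metis Diff_eq_empty_iff IntI centre_in_ball connected_ball empty_iff)
qed

text \<open>The part of \<open>K\<close> at distance at least \<open>e\<close> from \<open>a\<close>
  is closed and strictly farther from \<open>x\<close> than \<open>K\<close> is. Since distances to
  a set are 1-Lipschitz, half of this gap is a safe radius.\<close>

lemma nearest_points_upper_semicontinuous: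
  fixes K :: "'a::euclidean_space set"
  assumes K: "closed K"
    and uniq: "\<And>b. b \<in> K \<Longrightarrow> dist x b = infdist x K \<Longrightarrow> b = a" and "e > 0"
  shows "\<exists>d>0. \<forall>y. dist y x < d \<longrightarrow> (\<forall>b\<in>K. dist y b = infdist y K \<longrightarrow> dist b a < e)"
proof (cases "K \<inter> - ball a e = {}")
  \<comment> \<open>Treated separately because \<open>infdist\<close> to the empty set is
    \<open>0\<close>, which would spoil the comparison of distances.\<close>
  case True
  then have "dist b a < e" if "b \<in> K" for b using that by (auto simp: dist_commute)
  then show ?thesis by (intro exI[of _ 1]) simp
next
  case False
  define K' where "K' = K \<inter> - ball a e"
  have "closed K'" using K by (simp add: K'_def closed_Int closed_Compl)
  then obtain b where b: "b \<in> K'" "infdist x K' = dist x b"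
    using infdist_attains_inf False unfolding K'_def by metis
  have "b \<in> K" "b \<noteq> a" using b \<open>e > 0\<close> by (auto simp: K'_def)
  then have "infdist x K < infdist x K'"
    using uniq[of b] b infdist_le[of b K x] by fastforce
  moreover
  have False if y: "dist y x < (infdist x K' - infdist x K) / 2" and c: "c \<in> K" "dist y c = infdist y K"
    and far: "\<not> dist c a < e" for y c
  proof -
    have "c \<in> K'" using c far by (simp add: K'_def dist_commute)
    then have "infdist x K' \<le> dist x c" by (rule infdist_le)
    also have "\<dots> \<le> dist y x + infdist y K" using c by (metis dist_commute dist_triangle)
    also have "\<dots> \<le> dist y x + (infdist x K + dist y x)" using infdist_triangle[of y K x] by simp
    finally show False using y by simp
  qed
  ultimately show ?thesis
    by (intro exI[of _ "(infdist x K' - infdist x K) / 2"]) auto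
qed

text \<open>The foot of each of two points is a competitor for the other. This bounds the increment
  of the squared distance from both sides, and the bounds differ by a term that continuity of
  \<open>p\<close> makes small.\<close>

lemma infdist_square_has_derivative:
  fixes K :: "'a::euclidean_space set"
  assumes K: "closed K" and U: "open U"
    and p: "\<And>x. x \<in> U \<Longrightarrow> p x \<in> K" "\<And>x. x \<in> U \<Longrightarrow> dist x (p x) = infdist x K"
    and uniq: "\<And>x b. x \<in> U \<Longrightarrow> b \<in> K \<Longrightarrow> dist x b = infdist x K \<Longrightarrow> b = p x"
  shows "continuous_on U p"
    and "x \<in> U \<Longrightarrow> ((\<lambda>x. (infdist x K)\<^sup>2) has_derivative (\<lambda>v. (2 *\<^sub>R (x - p x)) \<bullet> v)) (at x)"
proof -
  show cont: "continuous_on U p"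
    unfolding continuous_on_iff
  proof (intro ballI allI impI)
    fix x e :: real and y assume "y \<in> U" "0 < e"
    then obtain d where "d > 0" "\<forall>z. dist z y < d \<longrightarrow> (\<forall>b\<in>K. dist z b = infdist z K \<longrightarrow> dist b (p y) < e)"
      using nearest_points_upper_semicontinuous[OF K, of y "p y" e] uniq by metis
    then show "\<exists>d>0. \<forall>z\<in>U. dist z y < d \<longrightarrow> dist (p z) (p y) < e"
      using p by blast
  qed
  assume x: "x \<in> U"
  show "((\<lambda>x. (infdist x K)\<^sup>2) has_derivative (\<lambda>v. (2 *\<^sub>R (x - p x)) \<bullet> v)) (at x)"
    unfolding has_derivative_at_alt
  proof (intro conjI allI impI)
    show "bounded_linear ((\<bullet>) (2 *\<^sub>R (x - p x)))" by (rule bounded_linear_inner_right)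
    fix e :: real assume e: "0 < e"
    obtain d1 where d1: "d1 > 0" "\<And>y. y \<in> U \<Longrightarrow> dist y x < d1 \<Longrightarrow> dist (p y) (p x) < e / 2"
      using cont x e unfolding continuous_on_iff by (metis half_gt_zero)
    obtain d2 where d2: "d2 > 0" "ball x d2 \<subseteq> U" using U x open_contains_ball by blast
    have main: "norm ((infdist y K)\<^sup>2 - (infdist x K)\<^sup>2 - 2 *\<^sub>R (x - p x) \<bullet> (y - x)) \<le> e * norm (y - x)"
      if y: "norm (y - x) < min e (min d1 d2)" for y
    proof -
      define k where "k = y - x"
      have yU: "y \<in> U" using y d2 by (auto simp: dist_norm norm_minus_commute)
      have pyx: "norm (p x - p y) \<le> e / 2"
        using d1(2)[OF yU] y by (simp add: dist_norm norm_minus_commute)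
      have y': "y = x + k" by (simp add: k_def)
      \<comment> \<open>An exact expansion whose quadratic term does not depend on \<open>q\<close>;
        it is used for \<open>q = p x\<close> and \<open>q = p y\<close>.\<close>
      have sq: "(dist (x + k) q)\<^sup>2 - (dist x q)\<^sup>2 = 2 * (k \<bullet> (x - q)) + k \<bullet> k" for q
      proof -
        have "x + k - q = (x - q) + k" by simp
        then show ?thesis
          unfolding dist_norm power2_norm_eq_inner
          by (simp only: inner_add_left inner_add_right inner_commute[of "x - q" k])
      qed
      have "(infdist y K)\<^sup>2 \<le> (dist y (p x))\<^sup>2"
        using infdist_le[OF p(1)[OF x]] by (simp add: power_mono infdist_nonneg)
      then have up: "(infdist y K)\<^sup>2 - (infdist x K)\<^sup>2 \<le> 2 * (k \<bullet> (x - p x)) + k \<bullet> k"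
        using sq[of "p x"] p(2)[OF x] y' by simp
      have "(infdist x K)\<^sup>2 \<le> (dist x (p y))\<^sup>2"
        using infdist_le[OF p(1)[OF yU]] by (simp add: power_mono infdist_nonneg)
      then have "2 * (k \<bullet> (x - p y)) + k \<bullet> k \<le> (infdist y K)\<^sup>2 - (infdist x K)\<^sup>2"
        using sq[of "p y"] p(2)[OF yU] y' by simp
      then have lo: "2 * (k \<bullet> (x - p x)) + 2 * (k \<bullet> (p x - p y)) \<le> (infdist y K)\<^sup>2 - (infdist x K)\<^sup>2"
        using inner_ge_zero[of k] unfolding inner_diff_right by argo
      have "2 * \<bar>k \<bullet> (p x - p y)\<bar> \<le> e * norm k"
        using Cauchy_Schwarz_ineq2[of k "p x - p y"] mult_left_mono[OF pyx norm_ge_zero[of k]]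
        by (simp add: mult.commute)
      moreover have "k \<bullet> k \<le> e * norm k"
        using y mult_right_mono[of "norm k" e "norm k"]
        by (simp add: k_def dot_square_norm power2_eq_square)
      moreover have "2 *\<^sub>R (x - p x) \<bullet> k = 2 * (k \<bullet> (x - p x))"
        by (simp add: inner_commute)
      ultimately show ?thesis
        using up lo unfolding k_def[symmetric] real_norm_def by linarith
    qed
    show "\<exists>d>0. \<forall>y. norm (y - x) < d \<longrightarrow>
        norm ((infdist y K)\<^sup>2 - (infdist x K)\<^sup>2 - 2 *\<^sub>R (x - p x) \<bullet> (y - x)) \<le> e * norm (y - x)"
      by (rule exI[of _ "min e (min d1 d2)"]) (use main e d1 d2 in auto)
  qed
qed

text \<open>The closed ball of radius \<open>t\<close> about \<open>a + t *\<^sub>R n\<close> meets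
  the complement of the empty ball only at \<open>a\<close>. In formulas, \<open>2 * \<rho> * (w
  \<bullet> n) \<le> w \<bullet> w \<le> 2 * t * (w \<bullet> n)\<close> with
  \<open>t < \<rho>\<close> forces \<open>w = 0\<close>.\<close>

lemma foot_of_normal_unique:
  fixes n :: "'a::euclidean_space"
  assumes a: "a \<in> K" and n: "norm n = 1" and empty: "ball (a + \<rho> *\<^sub>R n) \<rho> \<inter> K = {}"
    and t: "0 \<le> t" "t < \<rho>" and b: "b \<in> K" "dist (a + t *\<^sub>R n) b = infdist (a + t *\<^sub>R n) K"
  shows "b = a"
proof -
  define w where "w = b - a"
  have sq: "(dist (a + s *\<^sub>R n) b)\<^sup>2 = w \<bullet> w - 2 * s * (w \<bullet> n) + s\<^sup>2" for s
  proof -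
    have 1: "a + s *\<^sub>R n - b = s *\<^sub>R n - w" by (simp add: w_def)
    have 2: "n \<bullet> n = 1" using n by (simp add: dot_square_norm)
    show ?thesis
      unfolding dist_norm power2_norm_eq_inner 1
      by (simp add: inner_diff_left inner_diff_right inner_commute[of n w] power2_eq_square 2 right_diff_distrib)
  qed
  have "\<rho> \<le> dist (a + \<rho> *\<^sub>R n) b"
    using empty b(1) by (meson disjoint_iff mem_ball not_le)
  then have "\<rho>\<^sup>2 \<le> (dist (a + \<rho> *\<^sub>R n) b)\<^sup>2" using t by (simp add: power_mono)
  then have 1: "2 * \<rho> * (w \<bullet> n) \<le> w \<bullet> w" using sq[of \<rho>] by simp
  have "dist (a + t *\<^sub>R n) b \<le> t"
    using b(2) infdist_le[OF a, of "a + t *\<^sub>R n"] n t by (simp add: dist_norm)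
  then have "(dist (a + t *\<^sub>R n) b)\<^sup>2 \<le> t\<^sup>2" by (simp add: power_mono)
  then have 2: "w \<bullet> w \<le> 2 * t * (w \<bullet> n)" using sq[of t] by simp
  have "w \<bullet> w \<le> 0"
  proof (rule ccontr)
    assume "\<not> w \<bullet> w \<le> 0"
    then have "0 < t * (w \<bullet> n)" using 2 by simp
    then have "0 < w \<bullet> n" using t by (simp add: zero_less_mult_iff)
    then have "t * (w \<bullet> n) < \<rho> * (w \<bullet> n)" using t by simp
    with 1 2 show False by simp
  qed
  then have "w = 0" using inner_gt_zero_iff[of w] by linarith
  then show "b = a" by (simp add: w_def)
qed

text \<open>With a non-empty boundary the two conventions for the empty infimum do not matter, so
  the facts about \<open>infdist\<close> become available.\<close>

lemma inner_parallel_set_eq: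
  fixes \<Omega> :: "'a::euclidean_space set"
  assumes "frontier \<Omega> \<noteq> {}"
  shows "inner_parallel_set \<Omega> r = {x \<in> \<Omega>. infdist x (frontier \<Omega>) = r}"
proof -
  have "dist_fun (frontier \<Omega>) x = ereal (infdist x (frontier \<Omega>))" for x
  proof (rule antisym)
    obtain b where b: "b \<in> frontier \<Omega>" "infdist x (frontier \<Omega>) = dist x b"
      using infdist_attains_inf[OF frontier_closed assms] by blast
    have "dist_fun (frontier \<Omega>) x \<le> ereal (norm (x - b))"
      unfolding dist_fun_def using b(1) by (rule INF_lower)
    then show "dist_fun (frontier \<Omega>) x \<le> ereal (infdist x (frontier \<Omega>))"
      by (simp add: b(2) dist_norm)
    show "ereal (infdist x (frontier \<Omega>)) \<le> dist_fun (frontier \<Omega>) x"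
      unfolding dist_fun_def dist_norm[symmetric] by (rule INF_greatest) (simp add: infdist_le)
  qed
  then show ?thesis by (auto simp: inner_parallel_set_def)
qed


section \<open>From inner balls to a parallel hypersurface\<close>

text \<open>Near \<open>x0 = a0 + r *\<^sub>R n a0\<close> every nearest boundary point is close to
  \<open>a0\<close>, so the point lies on its normal line, on the side of the empty ball; hence its
  foot is unique.\<close>

lemma inner_parallel_hypersurface:
  fixes \<Omega> :: "'a::euclidean_space set"
  assumes "open \<Omega>" and C1: "C1_hypersurface (frontier \<Omega>)"
    and S: "openin (top_of_set (frontier \<Omega>)) S" "S \<noteq> {}" and ibc: "inner_uniform_ball_condition \<Omega> S"
  obtains r U where "r > 0" "open U" "U \<subseteq> \<Omega>" "inner_parallel_set \<Omega> r \<inter> U \<noteq> {}"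
    "C1_hypersurface (inner_parallel_set \<Omega> r \<inter> U)"
proof -
  define K where "K = frontier \<Omega>"
  have K: "closed K" by (simp add: K_def)
  have \<Omega>K: "\<Omega> \<inter> K = {}" using \<open>open \<Omega>\<close> by (simp add: K_def frontier_def interior_open Diff_Int_distrib)
  obtain \<rho> where "\<rho> > 0" and \<rho>: "\<And>y. y \<in> S \<Longrightarrow> \<exists>c. ball c \<rho> \<subseteq> \<Omega> \<and> dist y c = \<rho>"
    using ibc unfolding inner_uniform_ball_condition_def
    by (auto simp: frontier_ball dist_commute)
  obtain T where T: "open T" "S = K \<inter> T"
    using S(1) unfolding K_def openin_open by blast
  obtain a where a: "a \<in> K" "a \<in> T" using S(2) T by blast
  obtain V0 h0 g0 where V0: "a \<in> V0" "local_equation K V0 h0 g0"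
    using C1_hypersurface_imp_local_equation[OF C1] a unfolding K_def by blast
  have "open V0" using V0 by (simp add: local_equation_def)
  then have eq0: "local_equation K (V0 \<inter> T) h0 g0"
    using local_equation_subset[OF V0(2)] T by blast
  \<comment> \<open>A closed description of the admissible centres, whereas \<open>ball c \<rho> \<subseteq> \<Omega>\<close> is not visibly closed in \<open>c\<close>.\<close>
  define C where "C = {c. \<rho> \<le> infdist c K} \<inter> closure \<Omega>"
  have "closed {c. \<rho> \<le> infdist c K}"
    by (rule closed_Collect_le[OF continuous_on_const]) (intro continuous_on_infdist continuous_on_id)
  then have "closed C" by (simp add: C_def closed_Int)
  have CI: "ball c \<rho> \<subseteq> \<Omega>" if "c \<in> C" for c
  proof (rule ball_subset_if_disjoint_frontier)
    have "c \<notin> K" using that \<open>\<rho> > 0\<close> by (auto simp: C_def)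
    then show "c \<in> \<Omega>" using that \<open>open \<Omega>\<close> by (simp add: C_def K_def frontier_def interior_open)
    show "ball c \<rho> \<inter> frontier \<Omega> = {}"
      using that ball_Int_eq_empty_if_le_infdist unfolding C_def K_def by blast
  qed fact
  have sides: "y + \<rho> *\<^sub>R sgn (g0 y) \<in> C \<or> y - \<rho> *\<^sub>R sgn (g0 y) \<in> C" if y: "y \<in> K \<inter> (V0 \<inter> T)" for y
  proof -
    obtain c where c: "ball c \<rho> \<subseteq> \<Omega>" "dist y c = \<rho>" using \<rho> y T by blast
    have empty: "ball c \<rho> \<inter> K = {}" using c \<Omega>K by blast
    have "\<rho> \<le> infdist c K"
    proof -
      obtain b where "b \<in> K" "infdist c K = dist c b"
        using infdist_attains_inf[OF K, of c] a by blast
      then show ?thesis using empty by (metis disjoint_iff mem_ball not_le)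
    qed
    moreover have "c \<in> closure \<Omega>" using c \<open>\<rho> > 0\<close> by (meson centre_in_ball closure_subset subsetD)
    ultimately have "c \<in> C" by (simp add: C_def)
    then show ?thesis using center_of_empty_ball[OF eq0 _ _ c(2) empty] y by auto
  qed
  have "K \<inter> (V0 \<inter> T) \<noteq> {}" using a V0 by blast
  then obtain W h g where eq: "local_equation K W h g" and KW: "K \<inter> W \<noteq> {}"
    and C: "\<forall>y \<in> K \<inter> W. y + \<rho> *\<^sub>R sgn (g y) \<in> C"
    using choose_side[OF eq0 _ \<open>closed C\<close> sides] by meson
  define n where "n = (\<lambda>y. sgn (g y))"
  have n: "norm (n y) = 1" if "y \<in> W" for y using norm_unit_normal[OF eq that] by (simp add: n_def)
  have empty: "ball (y + \<rho> *\<^sub>R n y) \<rho> \<inter> K = {}" if "y \<in> K \<inter> W" for y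
    using CI[OF bspec[OF C that]] \<Omega>K by (auto simp: n_def)
  obtain a0 where a0: "a0 \<in> K" "a0 \<in> W" using KW by blast
  \<comment> \<open>Half the radius leaves room: points near \<open>x0\<close> still have distance
    less than \<open>\<rho>\<close> from \<open>K\<close>, as uniqueness of the foot
    requires.\<close>
  define r where "r = \<rho> / 2"
  have r: "r > 0" "r < \<rho>" using \<open>\<rho> > 0\<close> by (auto simp: r_def)
  define x0 where "x0 = a0 + r *\<^sub>R n a0"
  have x0a0: "dist x0 a0 = r" using n[OF a0(2)] r by (simp add: x0_def dist_norm)
  have uniq0: "b = a0" if "b \<in> K" "dist x0 b = infdist x0 K" for b
    using foot_of_normal_unique[OF a0(1) n[OF a0(2)] empty, of r b] a0 r that by (simp add: x0_def)
  have x0K: "infdist x0 K = r"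
  proof -
    obtain b where "b \<in> K" "infdist x0 K = dist x0 b"
      using infdist_attains_inf[OF K, of x0] a0 by blast
    then show ?thesis using uniq0 x0a0 by metis
  qed
  obtain e1 where e1: "e1 > 0" "ball a0 e1 \<subseteq> W \<inter> (\<lambda>y. n y \<bullet> n a0) -` {0<..}"
  proof -
    have "continuous_on W n" using continuous_on_unit_normal[OF eq] by (simp add: n_def)
    then have "open (W \<inter> (\<lambda>y. n y \<bullet> n a0) -` {0<..})"
      by (intro continuous_open_preimage continuous_intros) (use eq in \<open>auto simp: local_equation_def\<close>)
    moreover have "n a0 \<bullet> n a0 > 0" using n[OF a0(2)] by (simp add: dot_square_norm)
    ultimately show thesis using that a0 by (metis IntI greaterThan_iff open_contains_ball vimageI)
  qed
  \<comment> \<open>Radius \<open>e1\<close> keeps the normal at a nearest point at an acute angle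
    to \<open>n a0\<close>. The two bounds \<open>r / 4\<close>, on \<open>x - x0\<close> and on
    \<open>p - a0\<close>, keep \<open>x - p\<close> within \<open>r / 2\<close> of
    \<open>r *\<^sub>R n a0\<close>.\<close>
  have "0 < min e1 (r / 4)" using e1 r by simp
  then obtain d where d: "d > 0"
    "\<forall>x. dist x x0 < d \<longrightarrow> (\<forall>b\<in>K. dist x b = infdist x K \<longrightarrow> dist b a0 < min e1 (r / 4))"
    using nearest_points_upper_semicontinuous[of K x0 a0 "min e1 (r / 4)", OF K uniq0] by auto
  define U where "U = ball x0 (min d (r / 4))"
  have x0U: "x0 \<in> U" using d r by (simp add: U_def)
  have U\<Omega>: "U \<subseteq> \<Omega>"
  proof -
    have "U \<subseteq> ball (a0 + \<rho> *\<^sub>R n a0) \<rho>"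
    proof
      fix x assume "x \<in> U"
      then have "dist x0 x < r" using r by (auto simp: U_def)
      moreover have "dist (a0 + \<rho> *\<^sub>R n a0) x0 = \<rho> - r"
        using n[OF a0(2)] r by (simp add: x0_def dist_norm flip: scaleR_diff_left)
      ultimately show "x \<in> ball (a0 + \<rho> *\<^sub>R n a0) \<rho>"
        using dist_triangle[of "a0 + \<rho> *\<^sub>R n a0" x x0] by simp
    qed
    also have "\<dots> \<subseteq> \<Omega>" using CI C a0 by (auto simp: n_def)
    finally show ?thesis .
  qed
  have foot: "\<exists>p. p \<in> K \<and> dist x p = infdist x K \<and> (\<forall>b\<in>K. dist x b = infdist x K \<longrightarrow> b = p)" if x: "x \<in> U" for x
  proof -
    obtain p where "p \<in> K" "infdist x K = dist x p"
      using infdist_attains_inf[OF K, of x] a0 by blast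
    then have p: "p \<in> K" "dist x p = infdist x K" by simp_all
    define t where "t = infdist x K"
    have xx0: "dist x x0 < d" "dist x x0 < r / 4" using x by (auto simp: U_def dist_commute)
    have pa0: "dist p a0 < e1" "dist p a0 < r / 4" using d(2) xx0(1) p by auto
    then have pW: "p \<in> W" and pos: "n p \<bullet> n a0 > 0" using e1 by (auto simp: dist_commute subset_iff)
    have t0: "t \<ge> 0" by (simp add: t_def infdist_nonneg)
    have "t \<le> dist x x0 + infdist x0 K" using infdist_triangle[of x K x0] by (simp add: t_def)
    then have "t < \<rho>" using xx0(2) x0K r by (simp add: r_def)
    have "ball x t \<inter> K = {}" by (simp add: t_def ball_Int_eq_empty_if_le_infdist)
    then have "x = p + t *\<^sub>R n p \<or> x = p - t *\<^sub>R n p"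
      using center_of_empty_ball[OF eq p(1) pW, of x t] p by (simp add: t_def n_def dist_commute)
    \<comment> \<open>On the wrong side \<open>(x - p) \<bullet> n a0\<close> would be at most
      \<open>0\<close>, whereas the choice of radii makes it at least \<open>r / 2\<close>.\<close>
    moreover have "x \<noteq> p - t *\<^sub>R n p"
    proof
      assume "x = p - t *\<^sub>R n p"
      then have "(x - p) \<bullet> n a0 \<le> 0" using t0 pos by simp
      moreover have "(x - p) \<bullet> n a0 = r + ((x - x0) - (p - a0)) \<bullet> n a0"
      proof -
        have "x - p = r *\<^sub>R n a0 + ((x - x0) - (p - a0))" by (simp add: x0_def)
        moreover have "n a0 \<bullet> n a0 = 1" using n[OF a0(2)] by (simp add: dot_square_norm)
        ultimately show ?thesis by (metis inner_add_left inner_scaleR_left mult.right_neutral)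
      qed
      moreover have "\<bar>((x - x0) - (p - a0)) \<bullet> n a0\<bar> \<le> norm ((x - x0) - (p - a0))"
        using Cauchy_Schwarz_ineq2[of "(x - x0) - (p - a0)" "n a0"] n[OF a0(2)] by simp
      moreover have "norm ((x - x0) - (p - a0)) \<le> r / 4 + r / 4"
        using norm_triangle_ineq4[of "x - x0" "p - a0"] xx0(2) pa0(2) by (simp add: dist_norm)
      ultimately show False using r by linarith
    qed
    ultimately have x': "x = p + t *\<^sub>R n p" by blast
    have "b = p" if "b \<in> K" "dist x b = infdist x K" for b
      using foot_of_normal_unique[OF p(1) n[OF pW] empty t0 \<open>t < \<rho>\<close>, of b] pW p that x' by auto
    with p show ?thesis by blast
  qed
  then obtain p where p: "\<And>x. x \<in> U \<Longrightarrow> p x \<in> K" "\<And>x. x \<in> U \<Longrightarrow> dist x (p x) = infdist x K"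
    "\<And>x b. x \<in> U \<Longrightarrow> b \<in> K \<Longrightarrow> dist x b = infdist x K \<Longrightarrow> b = p x"
    by metis
  have "open U" by (simp add: U_def)
  have cp: "continuous_on U p"
    by (rule infdist_square_has_derivative(1)[where U = U and p = p and K = K]) (fact K p \<open>open U\<close>)+
  have dp: "((\<lambda>x. (infdist x K)\<^sup>2) has_derivative (\<lambda>v. (2 *\<^sub>R (x - p x)) \<bullet> v)) (at x)" if "x \<in> U" for x
    by (rule infdist_square_has_derivative(2)[where U = U and p = p and K = K]) (fact K p \<open>open U\<close> that)+
  define M where "M = inner_parallel_set \<Omega> r \<inter> U"
  have M: "M = {x \<in> U. infdist x K = r}"
    using inner_parallel_set_eq[of \<Omega> r] a0 U\<Omega> by (auto simp: M_def K_def)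
  have "local_equation M U (\<lambda>x. (infdist x K)\<^sup>2 - r\<^sup>2) (\<lambda>x. 2 *\<^sub>R (x - p x))"
    unfolding local_equation_def
  proof (intro conjI ballI)
    show "((\<lambda>x. (infdist x K)\<^sup>2 - r\<^sup>2) has_derivative (\<lambda>v. 2 *\<^sub>R (x - p x) \<bullet> v)) (at x)" if "x \<in> U" for x
      using has_derivative_diff[OF dp[OF that] has_derivative_const[of "r\<^sup>2"]] by simp
    show "continuous_on U (\<lambda>x. 2 *\<^sub>R (x - p x))"
      by (intro continuous_intros cp)
    show "2 *\<^sub>R (x - p x) \<noteq> 0" if "x \<in> U" for x
      using p(1)[OF that] U\<Omega> \<Omega>K that by auto
    show "M \<inter> U = {x \<in> U. (infdist x K)\<^sup>2 - r\<^sup>2 = 0}"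
      using r by (auto simp: M infdist_nonneg dest: power2_eq_imp_eq)
  qed fact
  then have "C1_hypersurface M"
    by (intro local_equations_imp_C1_hypersurface) (auto simp: M)
  moreover have "x0 \<in> M" using x0U x0K by (simp add: M)
  ultimately show thesis using that[of r U] r \<open>open U\<close> U\<Omega> unfolding M_def by blast
qed

section \<open>From a parallel hypersurface to inner balls\<close>

text \<open>Read in charts, \<open>F\<close> is a continuous injection from an open part of one
  hyperplane into another of the same dimension, where invariance of domain applies.\<close>

lemma C1_hypersurface_invariance_of_domain:
  fixes M K :: "'a::euclidean_space set"
  assumes M: "C1_hypersurface M" and K: "C1_hypersurface K" and x0: "x0 \<in> M" "x0 \<in> W" and "open W"
    and F: "continuous_on W F" and FK: "F ` (M \<inter> W) \<subseteq> K" and inj: "inj_on F (M \<inter> W)"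
  obtains W' where "open W'" "x0 \<in> W'" "W' \<subseteq> W" "openin (top_of_set K) (F ` (M \<inter> W'))"
proof -
  obtain V1 Z1 and \<sigma>1 :: "'a \<Rightarrow> 'a" where V1: "open V1" "x0 \<in> V1" and Z1: "subspace Z1" "dim Z1 = DIM('a) - 1"
    and \<sigma>1: "C1_diffeomorphism V1 (\<sigma>1 ` V1) \<sigma>1" and MZ: "\<sigma>1 ` (V1 \<inter> M) = Z1 \<inter> \<sigma>1 ` V1"
    using M x0 unfolding C1_hypersurface_def by meson
  have "F x0 \<in> K" using FK x0 by blast
  then obtain V2 Z2 and \<sigma>2 :: "'a \<Rightarrow> 'a" where V2: "open V2" "F x0 \<in> V2" and Z2: "subspace Z2" "dim Z2 = DIM('a) - 1"
    and \<sigma>2: "C1_diffeomorphism V2 (\<sigma>2 ` V2) \<sigma>2" and KZ: "\<sigma>2 ` (V2 \<inter> K) = Z2 \<inter> \<sigma>2 ` V2"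
    using K unfolding C1_hypersurface_def by meson
  define W' where "W' = W \<inter> F -` V2 \<inter> V1"
  have "open W'"
    unfolding W'_def by (intro open_Int continuous_open_preimage F V1 V2 \<open>open W\<close>)
  define \<tau> where "\<tau> = inv_into V1 \<sigma>1"
  have inj1: "inj_on \<sigma>1 V1" and inj2: "inj_on \<sigma>2 V2"
    using \<sigma>1 \<sigma>2 by (auto simp: C1_diffeomorphism_def bij_betw_def)
  have \<tau>: "\<tau> (\<sigma>1 x) = x" if "x \<in> V1" for x using inj1 that by (simp add: \<tau>_def)
  have c\<tau>: "continuous_on (\<sigma>1 ` V1) \<tau>" and c\<sigma>2: "continuous_on V2 \<sigma>2"
    using \<sigma>1 \<sigma>2 by (auto simp: C1_diffeomorphism_def \<tau>_def intro: C1_on_imp_continuous_on)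
  have opW: "open (\<sigma>1 ` W')"
  proof -
    have "\<sigma>1 ` W' = \<sigma>1 ` V1 \<inter> \<tau> -` W'" using \<tau> by (force simp: W'_def)
    moreover have "open (\<sigma>1 ` V1)" using \<sigma>1 by (simp add: C1_diffeomorphism_def)
    ultimately show ?thesis using continuous_open_preimage[OF c\<tau> _ \<open>open W'\<close>] by simp
  qed
  define T where "T = \<sigma>1 ` (M \<inter> W')"
  have TZ: "T = Z1 \<inter> \<sigma>1 ` W'"
  proof
    show "T \<subseteq> Z1 \<inter> \<sigma>1 ` W'" using MZ by (auto simp: T_def W'_def)
    show "Z1 \<inter> \<sigma>1 ` W' \<subseteq> T"
    proof
      fix z assume z: "z \<in> Z1 \<inter> \<sigma>1 ` W'"
      then obtain x where x: "x \<in> W'" "z = \<sigma>1 x" by blast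
      then have "z \<in> \<sigma>1 ` (V1 \<inter> M)" using MZ z by (auto simp: W'_def)
      then have "x \<in> M" using x inj1 by (auto simp: W'_def dest: inj_onD)
      then show "z \<in> T" using x by (simp add: T_def)
    qed
  qed
  have \<tau>T: "\<tau> ` T = M \<inter> W'" using \<tau> by (force simp: T_def W'_def)
  define \<Phi> where "\<Phi> = (\<lambda>z. \<sigma>2 (F (\<tau> z)))"
  have \<Phi>T: "\<Phi> ` T = \<sigma>2 ` F ` (M \<inter> W')" unfolding \<tau>T[symmetric] by (auto simp: \<Phi>_def)
  have FV: "F ` (M \<inter> W') \<subseteq> V2 \<inter> K" using FK by (auto simp: W'_def)
  have "openin (top_of_set Z2) (\<Phi> ` T)"
  proof (rule invariance_of_domain_subspaces)
    show "openin (top_of_set Z1) T" using TZ opW by (auto simp: openin_open)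
    show "continuous_on T \<Phi>"
    proof -
      have "T \<subseteq> \<sigma>1 ` V1" by (auto simp: T_def W'_def)
      then have cT: "continuous_on T \<tau>" by (rule continuous_on_subset[OF c\<tau>])
      have "continuous_on T (\<lambda>z. F (\<tau> z))"
        by (rule continuous_on_compose2[OF F cT]) (use \<tau>T in \<open>auto simp: W'_def\<close>)
      then show ?thesis
        unfolding \<Phi>_def by (rule continuous_on_compose2[OF c\<sigma>2]) (use \<tau>T FV in blast)
    qed
    show "\<Phi> \<in> T \<rightarrow> Z2" using \<Phi>T FV KZ by blast
    show "inj_on \<Phi> T"
    proof (rule inj_onI)
      fix y z assume yz: "y \<in> T" "z \<in> T" "\<Phi> y = \<Phi> z"
      then have *: "\<tau> y \<in> M \<inter> W'" "\<tau> z \<in> M \<inter> W'" using \<tau>T by auto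
      then have "F (\<tau> y) = F (\<tau> z)" using yz(3) FV inj2 unfolding \<Phi>_def by (meson IntD1 imageI inj_onD subsetD)
      then have "\<tau> y = \<tau> z" using * inj by (auto simp: W'_def dest: inj_onD)
      then show "y = z" using yz \<tau> by (auto simp: T_def W'_def)
    qed
  qed (use Z1 Z2 in simp_all)
  then obtain Q where Q: "open Q" "\<Phi> ` T = Z2 \<inter> Q" by (auto simp: openin_open)
  \<comment> \<open>Pulling the open set \<open>Q\<close> back along the chart of \<open>K\<close>
    exhibits the image as the trace on \<open>K\<close> of an open set.\<close>
  have "F ` (M \<inter> W') = K \<inter> (V2 \<inter> \<sigma>2 -` Q)"
  proof
    show "F ` (M \<inter> W') \<subseteq> K \<inter> (V2 \<inter> \<sigma>2 -` Q)" using FV \<Phi>T Q by blast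
    show "K \<inter> (V2 \<inter> \<sigma>2 -` Q) \<subseteq> F ` (M \<inter> W')"
    proof
      fix y assume y: "y \<in> K \<inter> (V2 \<inter> \<sigma>2 -` Q)"
      then have "\<sigma>2 y \<in> \<sigma>2 ` F ` (M \<inter> W')" using KZ Q \<Phi>T by blast
      then show "y \<in> F ` (M \<inter> W')" using inj2 y FV by (metis IntD1 IntD2 inj_on_image_mem_iff le_inf_iff)
    qed
  qed
  moreover have "open (V2 \<inter> \<sigma>2 -` Q)" by (intro continuous_open_preimage c\<sigma>2 V2 Q)
  ultimately have "openin (top_of_set K) (F ` (M \<inter> W'))" by (auto simp: openin_open)
  then show thesis using that[of W'] \<open>open W'\<close> x0 V1 V2 by (auto simp: W'_def)
qed

text \<open>Touching balls are used twice: balls about points of \<open>K\<close> give the normal to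
  \<open>M\<close> and hence the map \<open>F\<close>, and balls about points of \<open>M\<close>
  give the normal to \<open>K\<close> and hence local injectivity of \<open>F\<close>.\<close>

lemma inner_balls_from_parallel_hypersurface:
  fixes \<Omega> :: "'a::euclidean_space set"
  assumes "open \<Omega>" and C1: "C1_hypersurface (frontier \<Omega>)" and "r > 0" and U: "open U" "U \<subseteq> \<Omega>"
    and ne: "inner_parallel_set \<Omega> r \<inter> U \<noteq> {}" and hyp: "C1_hypersurface (inner_parallel_set \<Omega> r \<inter> U)"
  obtains S where "openin (top_of_set (frontier \<Omega>)) S" "S \<noteq> {}" "inner_uniform_ball_condition \<Omega> S"
proof -
  define K where "K = frontier \<Omega>"
  define M where "M = inner_parallel_set \<Omega> r \<inter> U"
  have K: "closed K" by (simp add: K_def)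
  \<comment> \<open>For an empty boundary \<open>dist_fun\<close> is infinite everywhere, so the
    parallel set would be empty.\<close>
  have K0: "K \<noteq> {}"
    using ne by (auto simp: K_def inner_parallel_set_def dist_fun_def top_ereal_def)
  have M: "M = {x \<in> U. infdist x K = r}"
    using inner_parallel_set_eq[of \<Omega> r] K0 U by (auto simp: M_def K_def)
  have C1M: "C1_hypersurface M" and C1K: "C1_hypersurface K" using hyp C1 by (auto simp: M_def K_def)
  have emptyK: "ball x r \<inter> K = {}" if "x \<in> M" for x
    using that by (intro ball_Int_eq_empty_if_le_infdist) (simp add: M)
  have emptyM: "ball \<xi> r \<inter> M = {}" if "\<xi> \<in> K" for \<xi>
  proof -
    have "r \<le> dist \<xi> z" if "z \<in> M" for z
      using infdist_le[OF \<open>\<xi> \<in> K\<close>, of z] that by (simp add: M dist_commute)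
    then show ?thesis by (meson disjoint_iff mem_ball not_le)
  qed
  obtain a where a: "a \<in> M" using ne by (auto simp: M_def)
  obtain V0 h0 g0 where V0: "a \<in> V0" and eq0: "local_equation M V0 h0 g0"
    using C1_hypersurface_imp_local_equation[OF C1M a] by blast
  have sides: "y + r *\<^sub>R sgn (g0 y) \<in> K \<or> y - r *\<^sub>R sgn (g0 y) \<in> K" if y: "y \<in> M \<inter> V0" for y
  proof -
    obtain \<xi> where \<xi>: "\<xi> \<in> K" "infdist y K = dist y \<xi>"
      using infdist_attains_inf[OF K K0] by blast
    then show ?thesis
      using center_of_empty_ball[OF eq0, of y \<xi> r] y emptyM by (auto simp: M)
  qed
  have "M \<inter> V0 \<noteq> {}" using a V0 by blast
  then obtain W h g where eq: "local_equation M W h g" and MW: "M \<inter> W \<noteq> {}"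
    and FK': "\<forall>y \<in> M \<inter> W. y + r *\<^sub>R sgn (g y) \<in> K"
    using choose_side[OF eq0 _ K sides] by meson
  obtain x0 where x0: "x0 \<in> M" "x0 \<in> W" using MW by blast
  define F where "F = (\<lambda>y. y + r *\<^sub>R sgn (g y))"
  have FK: "F y \<in> K" if "y \<in> M \<inter> W" for y using bspec[OF FK' that] by (simp add: F_def)
  have W: "open W" using eq by (simp add: local_equation_def)
  have cF: "continuous_on W F"
    unfolding F_def by (intro continuous_intros continuous_on_unit_normal[OF eq])
  have dF: "dist (F y) y = r" if "y \<in> W" for y
    using norm_unit_normal[OF eq that] \<open>r > 0\<close> by (simp add: F_def dist_norm)
  obtain V2 h2 g2 where V2: "F x0 \<in> V2" and eq2: "local_equation K V2 h2 g2"
    using C1_hypersurface_imp_local_equation[OF C1K FK] x0 by blast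
  \<comment> \<open>The half-space condition admits, for each common value of \<open>F\<close>, only
    one of the two opposite displacements along the normal to \<open>K\<close>.\<close>
  define N where "N = W \<inter> F -` V2 \<inter> (W \<inter> (\<lambda>x. (x - F x) \<bullet> (x0 - F x0)) -` {0<..})"
  have "open N"
    unfolding N_def
    by (intro open_Int continuous_open_preimage continuous_intros cF W)
      (use eq2 in \<open>auto simp: local_equation_def\<close>)
  have "x0 \<noteq> F x0" using dF[OF x0(2)] \<open>r > 0\<close> by auto
  then have x0N: "x0 \<in> N" using x0 V2 by (simp add: N_def)
  have NW: "N \<subseteq> W" by (auto simp: N_def)
  have "inj_on F (M \<inter> N)"
  proof (rule inj_onI)
    fix x y assume x: "x \<in> M \<inter> N" and y: "y \<in> M \<inter> N" and eqF: "F x = F y"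
    \<comment> \<open>All points with the image \<open>F x\<close> sit at \<open>F x\<close> plus or
      minus this one vector.\<close>
    define \<nu> where "\<nu> = r *\<^sub>R sgn (g2 (F x))"
    have *: "z - F z = \<nu> \<or> z - F z = - \<nu>" if z: "z \<in> M \<inter> N" "F z = F x" for z
    proof -
      have "z \<in> W" "F z \<in> V2" using z by (simp_all add: N_def)
      moreover have "F z \<in> K" using FK z NW by blast
      ultimately
      have "z = F z + r *\<^sub>R sgn (g2 (F z)) \<or> z = F z - r *\<^sub>R sgn (g2 (F z))"
        using center_of_empty_ball[OF eq2, of "F z" z r] dF emptyK z by blast
      then show ?thesis
        using z(2) by (auto simp: \<nu>_def algebra_simps)
    qed
    have pos: "(z - F z) \<bullet> (x0 - F x0) > 0" if "z \<in> M \<inter> N" for z using that by (simp add: N_def)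
    have "x - F x = y - F y"
    proof (rule ccontr)
      assume "x - F x \<noteq> y - F y"
      then have "x - F x = - (y - F y)"
        using *[OF x] *[OF y] eqF by (metis minus_minus)
      then show False using pos[OF x] pos[OF y] by (metis inner_minus_left neg_0_less_iff_less not_less_iff_gr_or_eq)
    qed
    then show "x = y" using eqF by simp
  qed
  moreover have "F ` (M \<inter> N) \<subseteq> K" using FK NW by blast
  ultimately obtain W' where W': "open W'" "x0 \<in> W'" "W' \<subseteq> N" "openin (top_of_set K) (F ` (M \<inter> W'))"
    using C1_hypersurface_invariance_of_domain[OF C1M C1K x0(1) x0N \<open>open N\<close> continuous_on_subset[OF cF NW]] by metis
  have "\<exists>c. ball c r \<subseteq> \<Omega> \<and> \<xi> \<in> frontier (ball c r)" if \<xi>: "\<xi> \<in> F ` (M \<inter> W')" for \<xi>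
  proof -
    obtain x where x: "x \<in> M" "x \<in> W'" "\<xi> = F x" using \<xi> by blast
    have "ball x r \<subseteq> \<Omega>"
      by (rule ball_subset_if_disjoint_frontier) (use x U emptyK \<open>r > 0\<close> in \<open>auto simp: M K_def\<close>)
    moreover have "dist x \<xi> = r" using dF x W' NW by (auto simp: dist_commute)
    ultimately show ?thesis using \<open>r > 0\<close> by (auto simp: frontier_ball)
  qed
  then have "inner_uniform_ball_condition \<Omega> (F ` (M \<inter> W'))"
    using \<open>r > 0\<close> unfolding inner_uniform_ball_condition_def by blast
  then show thesis using that W' x0 unfolding K_def by blast
qed

theorem theorem2p6:
  fixes \<Omega> :: "(real ^ 'n) set"
  assumes "open \<Omega>" and "has_C1_boundary \<Omega>"
  shows "(\<exists>S. openin (top_of_set (frontier \<Omega>)) S \<and> S \<noteq> {} \<and>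
             inner_uniform_ball_condition \<Omega> S)
     \<longleftrightarrow>
         (\<exists>r>0. \<exists>U. open U \<and> U \<subseteq> \<Omega> \<and>
             inner_parallel_set \<Omega> r \<inter> U \<noteq> {} \<and>
             C1_hypersurface (inner_parallel_set \<Omega> r \<inter> U))"
  using assms inner_parallel_hypersurface[of \<Omega>] inner_balls_from_parallel_hypersurface[of \<Omega>]
  unfolding has_C1_boundary_def by metis

end
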